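(* Let $\Bbbk$ be a field of characteristic $0$, let $n=4$, $s=2$, $d_1=d_2=2$, and let $\preceq$ be the lexicographic order on the monomials of $S=\Bbbk[x_1,x_2,x_3,x_4]$ with $x_1\succeq x_2\succeq x_3\succeq x_4$. Then there is no point $\mathbf{a}\in U$ such that $\operatorname{in}_{\preceq}(I_{\mathbf{a}})$ is a lexsegment ideal.
   Context: $S=\bigoplus_{d\ge0}S_d$ is graded with $\deg x_i=1$. There are $10$ monomials of degree $2$ in $S$. A point $\mathbf{a}=(a_{j,k})_{1\le j\le 2,\,1\le k\le 10}\in\mathbb{A}_{\Bbbk}^{20}=\Bbbk^{20}$ corresponds to the homogeneous ideal $I_{\mathbf{a}}=(f_1,f_2)\subset S$, where $f_j$ is the linear combination, with coefficients $a_{j,1},\ldots,a_{j,10}$, of all monomials of degree $2$ (in a fixed enumeration). For each $d\ge0$ let $t_d=\max_{\mathbf{a}}\dim_{\Bbbk}(I_{\mathbf{a}})_d$ (maximum over all $\mathbf{a}\in\mathbb{A}_{\Bbbk}^{20}$), let $U_d=\{\mathbf{a}:\dim_{\Bbbk}(I_{\mathbf{a}})_d=t_d\}$, and let $U=\bigcap_{d\ge0}U_d$, which is known to be a Zariski open dense subset of $\mathbb{A}_{\Bbbk}^{20}$. For an ideal $I$, $\operatorname{in}_{\preceq}(I)$ is the ideal spanned over $\Bbbk$ by the initial terms $\operatorname{in}_{\preceq}(f)$, $f\in I$. A monomial ideal $J\subset S$ is a lexsegment ideal if, for all monomials $m\in J$, every monomial $m'$ with $\deg(m')=\deg(m)$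 and $m\preceq m'$ in the lexicographic order also belongs to $J$. *)

theory Defs
  imports
    "HOL-Analysis.Finite_Cartesian_Product"
    "HOL-Library.Poly_Mapping"
    "HOL-Library.Numeral_Type"
begin

text \<open>
  Exponent vectors on the variables \<open>'v\<close> form the type \<open>'v \<Rightarrow>\<^sub>0 nat\<close>; the polynomial ring over \<open>'k\<close>
  is the monoid algebra \<open>('v \<Rightarrow>\<^sub>0 nat) \<Rightarrow>\<^sub>0 'k\<close> with its library ring structure.
  For four variables take \<open>'v = 4\<close>, whose elements are \<open>0 < 1 < 2 < 3\<close> and stand for
  $x_1, x_2, x_3, x_4$ in this order (beware that \<open>4 = (0::4)\<close>).
\<close>

type_synonym 'v mon = "'v \<Rightarrow>\<^sub>0 nat"
type_synonym ('v, 'k) mpol = "'v mon \<Rightarrow>\<^sub>0 'k"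

lemma UNIV_4: "(UNIV :: 4 set) = {0, 1, 2, 3}"
  and less_4: "(0::4) < 1" "(1::4) < 2" "(2::4) < 3"
proof -
  show less: "(0::4) < 1" "(1::4) < 2" "(2::4) < 3"
    by (simp_all add: less_bit0_def bit0.Rep_0 bit0.Rep_1 bit0.Rep_numeral)
  have "card {0, 1, 2, 3 :: 4} = CARD(4)"
    by simp
  then show "(UNIV :: 4 set) = {0, 1, 2, 3}"
    by (metis card_subset_eq finite subset_UNIV)
qed

text \<open>
  The library order on \<open>'v \<Rightarrow>\<^sub>0 nat\<close> is the (pure) lexicographic order in which smaller elements of
  \<open>'v\<close> are larger variables.
\<close>

lemma mon_less_iff_lex:
  fixes m m' :: "'v::linorder mon"
  shows "m < m' \<longleftrightarrow>
    (\<exists>i. Poly_Mapping.lookup m i < Poly_Mapping.lookup m' i \<and>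
      (\<forall>j<i. Poly_Mapping.lookup m j = Poly_Mapping.lookup m' j))"
  by (simp add: less_poly_mapping.rep_eq less_fun_def)

lemma single_less_single_4:
  "Poly_Mapping.single 1 1 < (Poly_Mapping.single 0 1 :: 4 mon)"
  "Poly_Mapping.single 2 1 < (Poly_Mapping.single 1 1 :: 4 mon)"
  "Poly_Mapping.single 3 1 < (Poly_Mapping.single 2 1 :: 4 mon)"
proof -
  have *: "Poly_Mapping.single j 1 < (Poly_Mapping.single i 1 :: 4 mon)" if "i < j" for i j :: 4
    unfolding mon_less_iff_lex using that
    by (intro exI[of _ i]) (auto simp: lookup_single when_def)
  show "Poly_Mapping.single 1 1 < (Poly_Mapping.single 0 1 :: 4 mon)"
    "Poly_Mapping.single 2 1 < (Poly_Mapping.single 1 1 :: 4 mon)"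
    "Poly_Mapping.single 3 1 < (Poly_Mapping.single 2 1 :: 4 mon)"
    by (intro * less_4)+
qed

definition mdeg :: "'v::finite mon \<Rightarrow> nat" where
  "mdeg m = (\<Sum>i\<in>UNIV. Poly_Mapping.lookup m i)"

definition monom :: "'v mon \<Rightarrow> ('v, 'k::zero_neq_one) mpol" where
  "monom m = Poly_Mapping.single m 1"

definition smult :: "'k::comm_ring_1 \<Rightarrow> ('v, 'k) mpol \<Rightarrow> ('v, 'k) mpol" where
  "smult c f = Poly_Mapping.single 0 c * f"

global_interpretation vs: vector_space "smult :: 'k::field \<Rightarrow> ('v, 'k) mpol \<Rightarrow> ('v, 'k) mpol"
  by standard
    (simp_all add: smult_def algebra_simps single_add mult_single flip: mult.assoc)

text \<open>The span of a subset of a commutative ring regarded as a module over itself is the ideal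
  generated by that subset.\<close>

global_interpretation ideal: module "(*) :: 'a::comm_ring_1 \<Rightarrow> 'a \<Rightarrow> 'a"
  by standard (simp_all add: algebra_simps)

definition graded_part :: "('v::finite, 'k::zero) mpol set \<Rightarrow> nat \<Rightarrow> ('v, 'k) mpol set" where
  "graded_part I d = {f \<in> I. \<forall>m\<in>Poly_Mapping.keys f. mdeg m = d}"

text \<open>
  \<open>e\<close> is the enumeration of the monomials occurring in the generators; a point \<open>a\<close> has the
  coefficients of the \<open>j\<close>-th generator in its \<open>j\<close>-th row.
\<close>

definition gen_form :: "('m::finite \<Rightarrow> 'v mon) \<Rightarrow> 'k::comm_ring_1^'m \<Rightarrow> ('v, 'k) mpol" where
  "gen_form e c = (\<Sum>k\<in>UNIV. smult (c $ k) (monom (e k)))"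

definition point_ideal ::
  "('m::finite \<Rightarrow> 'v mon) \<Rightarrow> 'k::comm_ring_1^'m^'s::finite \<Rightarrow> ('v, 'k) mpol set" where
  "point_ideal e a = ideal.span {gen_form e (a $ j) | j. True}"

definition hilb ::
  "('m::finite \<Rightarrow> 'v::finite mon) \<Rightarrow> 'k::field^'m^'s::finite \<Rightarrow> nat \<Rightarrow> nat" where
  "hilb e a d = vs.dim (graded_part (point_ideal e a) d)"

text \<open>\<open>Max\<close> is used on a set that is finite, see \<open>finite_hilb\<close> below. The type
  argument fixes the field and the number of generators.\<close>

definition max_hilb ::
  "('k::field^'m^'s::finite) itself \<Rightarrow> ('m::finite \<Rightarrow> 'v::finite mon) \<Rightarrow> nat \<Rightarrow> nat" where
  "max_hilb _ e d = Max {hilb e a d | a :: 'k^'m^'s. True}"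

definition max_locus_deg ::
  "('m::finite \<Rightarrow> 'v::finite mon) \<Rightarrow> nat \<Rightarrow> ('k::field^'m^'s::finite) set" where
  "max_locus_deg e d = {a. hilb e a d = max_hilb TYPE('k^'m^'s) e d}"

definition max_locus :: "('m::finite \<Rightarrow> 'v::finite mon) \<Rightarrow> ('k::field^'m^'s::finite) set" where
  "max_locus e = (\<Inter>d. max_locus_deg e d)"

lemma finite_mdeg: "finite {m :: 'v::finite mon. mdeg m = d}"
proof -
  have "Poly_Mapping.lookup ` {m :: 'v mon. mdeg m = d} \<subseteq> (UNIV \<rightarrow>\<^sub>E {..d})"
    by (auto simp: mdeg_def PiE_def intro: member_le_sum)
  then have "finite (Poly_Mapping.lookup ` {m :: 'v mon. mdeg m = d})"
    by (rule finite_subset) (simp add: finite_PiE)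
  then show ?thesis
    by (rule finite_imageD) (simp add: inj_on_def poly_mapping_eqI)
qed

lemma mpol_eq_sum_monom:
  fixes f :: "('v, 'k::comm_ring_1) mpol"
  shows "f = (\<Sum>m\<in>Poly_Mapping.keys f. smult (Poly_Mapping.lookup f m) (monom m))"
  by (rule poly_mapping_eqI)
    (auto simp: smult_def monom_def mult_single lookup_sum lookup_single when_def in_keys_iff)

lemma finite_hilb:
  fixes e :: "'m::finite \<Rightarrow> 'v::finite mon"
  shows "finite {hilb e a d | a :: 'k::field^'m^'s::finite. True}"
proof -
  let ?B = "monom ` {m :: 'v mon. mdeg m = d} :: ('v, 'k) mpol set"
  have "graded_part I d \<subseteq> vs.span ?B" for I :: "('v, 'k) mpol set"
  proof
    fix f assume "f \<in> graded_part I d"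
    then have "(\<Sum>m\<in>Poly_Mapping.keys f. smult (Poly_Mapping.lookup f m) (monom m)) \<in> vs.span ?B"
      by (intro vs.span_sum vs.span_scale vs.span_base) (auto simp: graded_part_def)
    then show "f \<in> vs.span ?B"
      using mpol_eq_sum_monom[of f] by simp
  qed
  then have "hilb e a d \<le> card ?B" for a :: "'k^'m^'s"
    unfolding hilb_def by (intro vs.dim_le_card finite_imageI finite_mdeg)
  then have "{hilb e a d | a :: 'k^'m^'s. True} \<subseteq> {..card ?B}"
    by auto
  then show ?thesis
    by (rule finite_subset) simp
qed

text \<open>Initial terms are taken with respect to the lexicographic order \<open>\<le>\<close> on monomials.\<close>

definition init_term :: "('v::linorder, 'k::zero) mpol \<Rightarrow> ('v, 'k) mpol" where
  "init_term f =
    (if f = 0 then 0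
     else let m = Max (Poly_Mapping.keys f) in Poly_Mapping.single m (Poly_Mapping.lookup f m))"

definition init_ideal :: "('v::linorder, 'k::field) mpol set \<Rightarrow> ('v, 'k) mpol set" where
  "init_ideal I = vs.span (init_term ` I)"

definition monomial_ideal :: "('v, 'k::comm_ring_1) mpol set \<Rightarrow> bool" where
  "monomial_ideal J \<longleftrightarrow> (\<exists>M. J = ideal.span (monom ` M))"

definition lexsegment_ideal :: "('v::{finite,linorder}, 'k::comm_ring_1) mpol set \<Rightarrow> bool" where
  "lexsegment_ideal J \<longleftrightarrow> monomial_ideal J \<and>
    (\<forall>m m'. monom m \<in> J \<longrightarrow> mdeg m' = mdeg m \<longrightarrow> m \<le> m' \<longrightarrow> monom m' \<in> J)"

end

theory Submission
  imports Defs "HOL-Analysis.Cartesian_Space"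
begin

text \<open>
  The proof looks at degree $4$ only. Comparison with the point $(x_1^2, x_2^2)$ shows that every
  point of the maximal locus has $\dim (I)_4 \ge 19$. If the initial ideal is a lexsegment ideal, it
  contains $x_1^2$, so after a change of generators $F = \alpha x_1^2 + a x_1 + b$ and
  $G = l x_1 + c$ with $\alpha \ne 0$ and $a, b, c, l$ free of $x_1$. Eliminating $x_1$ gives the
  resultant $R = \alpha c^2 - a c l + b l^2 \in (I)_4$. If $R = 0$, this is a syzygy independent of
  the Koszul syzygy, and $\dim (I)_4 \le 18$. If $R \ne 0$, the initial monomial of $R$ is free of
  $x_1$, so the lexsegment property puts it and all $20$ quartic monomials divisible by $x_1$ into the
  initial ideal; but $(I)_4$ is spanned by only $20$ products.
\<close>

text \<open>\<open>ideal.scale_scale\<close> loops with \<open>mult.assoc\<close>, and the other two rules rewrite the monomials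
  \<open>single 0 1\<close> and \<open>single 0 2\<close>, that is $x_1$ and $x_1^2$, to numerals.\<close>

declare ideal.scale_scale [simp del] single_one [simp del] single_numeral [simp del]

section \<open>Homogeneous components and supports\<close>

abbreviation mons :: "nat \<Rightarrow> 'v::finite mon set" where
  "mons d \<equiv> {m. mdeg m = d}"

definition hcomp :: "nat \<Rightarrow> ('v::finite, 'k::field) mpol \<Rightarrow> ('v, 'k) mpol" where
  "hcomp d f = (\<Sum>m\<in>mons d. smult (Poly_Mapping.lookup f m) (monom m))"

lemma mdeg_add [simp]: "mdeg (m + n) = mdeg m + mdeg n"
  by (simp add: mdeg_def lookup_add sum.distrib)

lemma mdeg_single [simp]: "mdeg (Poly_Mapping.single i k) = k"
  by (simp add: mdeg_def lookup_single when_def)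

lemma lookup_le_mdeg: "Poly_Mapping.lookup m i \<le> mdeg m"
  unfolding mdeg_def by (rule member_le_sum) auto

lemma lookup_smult [simp]: "Poly_Mapping.lookup (smult c f) m = c * Poly_Mapping.lookup f m"
  by (simp add: smult_def map.rep_eq when_def flip: mult_map_scale_conv_mult)

lemma lookup_monom: "Poly_Mapping.lookup (monom m) n = (1 when m = n)"
  by (simp add: monom_def lookup_single)

lemma keys_monom [simp]: "Poly_Mapping.keys (monom m :: ('v, 'k::zero_neq_one) mpol) = {m}"
  by (simp add: monom_def)

lemma monom_mult: "monom m * monom n = (monom (m + n) :: ('v, 'k::comm_ring_1) mpol)"
  by (simp add: monom_def mult_single)

lemma smult_mult_left: "smult c f * g = smult c (f * g)"
  by (simp add: smult_def mult.assoc)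

lemma lookup_hcomp:
  "Poly_Mapping.lookup (hcomp d f) m = (Poly_Mapping.lookup f m when mdeg m = d)"
  by (simp add: hcomp_def lookup_sum lookup_monom mult_when) (simp add: when_def finite_mdeg)

lemma keys_hcomp: "Poly_Mapping.keys (hcomp d f) = Poly_Mapping.keys f \<inter> mons d"
  by (auto simp: in_keys_iff lookup_hcomp)

lemma hcomp_add: "hcomp d (f + g) = hcomp d f + hcomp d g"
  by (rule poly_mapping_eqI) (simp add: lookup_hcomp lookup_add when_def)

lemma hcomp_smult: "hcomp d (smult c f) = smult c (hcomp d f)"
  by (rule poly_mapping_eqI) (simp add: lookup_hcomp when_def)

lemma hcomp_sum: "hcomp d (\<Sum>i\<in>A. f i) = (\<Sum>i\<in>A. hcomp d (f i))"
  by (rule poly_mapping_eqI) (simp add: lookup_hcomp lookup_sum when_def)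

lemma hcomp_homogeneous:
  assumes "Poly_Mapping.keys f \<subseteq> mons k"
  shows "hcomp d f = (if d = k then f else 0)"
  by (rule poly_mapping_eqI) (use assms in \<open>auto simp: lookup_hcomp when_def in_keys_iff\<close>)

lemma keys_mult_mons:
  fixes f g :: "('v::finite, 'k::field) mpol"
  assumes "Poly_Mapping.keys f \<subseteq> mons d" "Poly_Mapping.keys g \<subseteq> mons k"
  shows "Poly_Mapping.keys (f * g) \<subseteq> mons (d + k)"
  using keys_mult[of f g] assms by force

section \<open>Spans of monomial multiples\<close>

lemma mult_in_span:
  fixes p F :: "('v, 'k::field) mpol"
  assumes "Poly_Mapping.keys p \<subseteq> A"
  shows "p * F \<in> vs.span ((\<lambda>m. monom m * F) ` A)"
proof -
  have "p * F = (\<Sum>m\<in>Poly_Mapping.keys p. smult (Poly_Mapping.lookup p m) (monom m * F))"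
    by (subst mpol_eq_sum_monom[of p]) (simp add: sum_distrib_right smult_mult_left)
  also have "\<dots> \<in> vs.span ((\<lambda>m. monom m * F) ` A)"
    using assms by (intro vs.span_sum vs.span_scale vs.span_base) auto
  finally show ?thesis .
qed

text \<open>Solve \<open>p * F\<close> for its term at \<open>m\<close>: the coefficient there is
  invertible and the remaining terms already lie in the span. This is how a syzygy makes a product
  redundant.\<close>

lemma pivot_in_span:
  fixes p F :: "('v, 'k::field) mpol"
  assumes keys: "Poly_Mapping.keys p \<subseteq> insert m A" and m: "Poly_Mapping.lookup p m \<noteq> 0"
    and W: "(\<lambda>m. monom m * F) ` A \<subseteq> vs.span W" and pF: "p * F \<in> vs.span W"
  shows "monom m * F \<in> vs.span W"
proof -
  define c where "c = Poly_Mapping.lookup p m"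
  define q where "q = p - smult c (monom m)"
  have "Poly_Mapping.keys q \<subseteq> A"
    using keys by (auto simp: q_def c_def in_keys_iff lookup_minus lookup_monom when_def split: if_splits)
  then have "q * F \<in> vs.span W"
    using mult_in_span[of q A F] vs.span_minimal[OF W vs.subspace_span] by auto
  with pF have "p * F - q * F \<in> vs.span W"
    by (rule vs.span_diff)
  also have "p * F - q * F = smult c (monom m * F)"
    by (simp add: q_def left_diff_distrib smult_mult_left)
  finally have "smult (inverse c) (smult c (monom m * F)) \<in> vs.span W"
    by (rule vs.span_scale)
  then show ?thesis
    using m by (simp add: c_def)
qed

text \<open>For forms \<open>F\<close>, \<open>G\<close> of degree k and
  \<open>A = B = mons d\<close>, these products span the degree d + k part of the ideal (F, G).
  Separate \<open>A\<close> and \<open>B\<close> allow single products to be dropped.\<close>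

definition multiples ::
  "'v mon set \<Rightarrow> ('v, 'k::field) mpol \<Rightarrow> 'v mon set \<Rightarrow> ('v, 'k) mpol \<Rightarrow> ('v, 'k) mpol set" where
  "multiples A F B G = (\<lambda>m. monom m * F) ` A \<union> (\<lambda>m. monom m * G) ` B"

lemma finite_multiples: "finite A \<Longrightarrow> finite B \<Longrightarrow> finite (multiples A F B G)"
  by (simp add: multiples_def)

lemma card_multiples:
  assumes "finite A" "finite B"
  shows "card (multiples A F B G) \<le> card A + card B"
  unfolding multiples_def
  by (meson add_mono assms card_Un_le card_image_le order_trans)

lemma mult_in_span_multiples:
  fixes F G p :: "('v, 'k::field) mpol"
  shows "Poly_Mapping.keys p \<subseteq> A \<Longrightarrow> p * F \<in> vs.span (multiples A F B G)"
    and "Poly_Mapping.keys p \<subseteq> B \<Longrightarrow> p * G \<in> vs.span (multiples A F B G)"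
  using mult_in_span[of p A F] mult_in_span[of p B G]
    vs.span_mono[of "(\<lambda>m. monom m * F) ` A" "multiples A F B G"]
    vs.span_mono[of "(\<lambda>m. monom m * G) ` B" "multiples A F B G"]
  by (auto simp: multiples_def)

section \<open>Graded parts of an ideal generated by two forms\<close>

lemma ideal_span_pair: "ideal.span {F, G} = {p * F + q * G | p q. True}"
  for F G :: "'a::comm_ring_1"
proof (intro equalityI subsetI)
  fix f assume "f \<in> ideal.span {F, G}"
  then obtain p q where "f - p * F = q * G"
    by (auto simp: ideal.span_breakdown_eq)
  then have "f = p * F + q * G"
    by (simp add: algebra_simps)
  then show "f \<in> {p * F + q * G | p q. True}"
    by blast
next
  fix f assume "f \<in> {p * F + q * G | p q. True}"
  then show "f \<in> ideal.span {F, G}"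
    by (auto intro!: ideal.span_add ideal.span_scale intro: ideal.span_base)
qed

text \<open>For a form H of degree k the component of p H in degree d + k is p_d H, so that of p F +
  q G is p_d F + q_d G.\<close>

lemma hcomp_ideal:
  fixes F G :: "('v::finite, 'k::field) mpol"
  assumes F: "Poly_Mapping.keys F \<subseteq> mons k" and G: "Poly_Mapping.keys G \<subseteq> mons k"
    and f: "f \<in> ideal.span {F, G}"
  shows "hcomp (d + k) f \<in> vs.span (multiples (mons d) F (mons d) G)"
proof -
  have hcomp_mult: "hcomp (d + k) (p * H) = hcomp d p * H" if "Poly_Mapping.keys H \<subseteq> mons k"
    for p H :: "('v, 'k) mpol"
  proof -
    \<comment> \<open>By linearity in \<open>p\<close> a monomial suffices; if \<open>mdeg m\<close>
      differs from \<open>d\<close>, both sides vanish.\<close>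
    have "hcomp (d + k) (monom m * H) = hcomp d (monom m) * H" for m
      using keys_mult_mons[of "monom m" "mdeg m" H k] that
      by (simp add: hcomp_homogeneous[where k = "mdeg m"] hcomp_homogeneous[where k = "mdeg m + k"])
    then have "hcomp (d + k) ((\<Sum>m\<in>Poly_Mapping.keys p. smult (Poly_Mapping.lookup p m) (monom m)) * H)
      = hcomp d (\<Sum>m\<in>Poly_Mapping.keys p. smult (Poly_Mapping.lookup p m) (monom m)) * H"
      by (simp add: sum_distrib_right hcomp_sum hcomp_smult smult_mult_left)
    then show ?thesis
      by (simp flip: mpol_eq_sum_monom)
  qed
  obtain p q where "f = p * F + q * G"
    using f by (auto simp: ideal_span_pair)
  then show ?thesis
    using F G by (auto simp: hcomp_add hcomp_mult keys_hcomp
        intro!: vs.span_add mult_in_span_multiples)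
qed

text \<open>The finite spanning set \<open>C\<close> forces bases of \<open>V\<close> to be finite;
  an infinite one would have \<open>card\<close> 0 and so give \<open>dim V = 0\<close>.\<close>

lemma (in vector_space) card_independent_le_dim:
  assumes "finite C" "V \<subseteq> span C" "S \<subseteq> V" "independent S"
  shows "card S \<le> dim V"
proof -
  obtain B where B: "B \<subseteq> V" "independent B" "V \<subseteq> span B" "card B = dim V"
    by (rule basis_exists)
  have "finite B"
    using independent_span_bound[OF assms(1) B(2)] B(1) assms(2) by blast
  then show ?thesis
    using independent_span_bound[of B S] B assms by auto
qed

lemma graded_part_subset_span:
  fixes F G :: "('v::finite, 'k::field) mpol"
  assumes "Poly_Mapping.keys F \<subseteq> mons k" "Poly_Mapping.keys G \<subseteq> mons k"
  shows "graded_part (ideal.span {F, G}) (d + k) \<subseteq> vs.span (multiples (mons d) F (mons d) G)"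
proof
  fix f assume f: "f \<in> graded_part (ideal.span {F, G}) (d + k)"
  then have "Poly_Mapping.keys f \<subseteq> mons (d + k)" "f \<in> ideal.span {F, G}"
    by (auto simp: graded_part_def)
  then show "f \<in> vs.span (multiples (mons d) F (mons d) G)"
    using hcomp_ideal[OF assms, of f d] hcomp_homogeneous[of f "d + k" "d + k"] by simp
qed

section \<open>Leading monomials and initial ideals\<close>

text \<open>In a vanishing combination, the largest leading monomial with nonzero coefficient cannot
  cancel. Indexing the family by its leading monomials makes them distinct.\<close>

lemma independent_distinct_Max_keys:
  fixes g :: "'v::linorder mon \<Rightarrow> ('v, 'k::field) mpol"
  assumes "finite M"
    and g: "\<And>m. m \<in> M \<Longrightarrow> g m \<noteq> 0 \<and> Max (Poly_Mapping.keys (g m)) = m"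
  shows "inj_on g M" "vs.independent (g ` M)"
proof -
  show inj: "inj_on g M"
    using g by (metis inj_onI)
  show "vs.independent (g ` M)"
  proof (rule ccontr)
    assume "\<not> vs.independent (g ` M)"
    then obtain u where u: "(\<Sum>v\<in>g ` M. smult (u v) v) = 0" "\<exists>v\<in>g ` M. u v \<noteq> 0"
      using assms(1) by (auto simp: vs.dependent_finite)
    define N where "N = {m \<in> M. u (g m) \<noteq> 0}"
    have "finite N" "N \<noteq> {}"
      using u(2) assms(1) by (auto simp: N_def)
    define n where "n = Max N"
    have n: "n \<in> N" "\<And>m. m \<in> N \<Longrightarrow> m \<le> n"
      using \<open>finite N\<close> \<open>N \<noteq> {}\<close> by (auto simp: n_def)
    \<comment> \<open>The leading monomial of such a \<open>g m\<close> is \<open>m\<close>, which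
      lies below \<open>n\<close>, so \<open>n\<close> does not occur in it.\<close>
    have zero: "Poly_Mapping.lookup (g m) n = 0" if "m \<in> N" "m \<noteq> n" for m
    proof (rule ccontr)
      assume "Poly_Mapping.lookup (g m) n \<noteq> 0"
      then have "n \<le> Max (Poly_Mapping.keys (g m))"
        by (intro Max_ge) (auto simp: in_keys_iff)
      then show False
        using g[of m] n(2)[of m] that by (auto simp: N_def)
    qed
    have "0 = Poly_Mapping.lookup (\<Sum>m\<in>M. smult (u (g m)) (g m)) n"
      using u(1) by (simp add: sum.reindex[OF inj])
    also have "\<dots> = (\<Sum>m\<in>M. u (g m) * Poly_Mapping.lookup (g m) n)"
      by (simp add: lookup_sum)
    also have "\<dots> = (\<Sum>m\<in>{n}. u (g m) * Poly_Mapping.lookup (g m) n)"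
      using n(1) zero assms(1) by (intro sum.mono_neutral_right) (auto simp: N_def)
    also have "\<dots> = u (g n) * Poly_Mapping.lookup (g n) n"
      by simp
    finally have "Poly_Mapping.lookup (g n) n = 0"
      using n(1) by (auto simp: N_def)
    moreover have "n \<in> Poly_Mapping.keys (g n)"
      using g[of n] n(1) Max_in[of "Poly_Mapping.keys (g n)"] by (auto simp: N_def)
    ultimately show False
      by (simp add: in_keys_iff)
  qed
qed

lemma monom_Max_in_init_ideal:
  assumes "f \<in> I" "f \<noteq> 0"
  shows "monom (Max (Poly_Mapping.keys f)) \<in> init_ideal I"
proof -
  let ?m = "Max (Poly_Mapping.keys f)"
  have "?m \<in> Poly_Mapping.keys f"
    using assms by (intro Max_in) auto
  then have "monom ?m = smult (inverse (Poly_Mapping.lookup f ?m)) (init_term f)"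
    using assms by (intro poly_mapping_eqI)
      (auto simp: init_term_def Let_def lookup_monom lookup_single when_def in_keys_iff)
  then show ?thesis
    unfolding init_ideal_def using assms(1) by (simp add: vs.span_scale vs.span_base)
qed

text \<open>If no nonzero element of \<open>I\<close> had leading monomial \<open>m\<close>, the
  coefficient at \<open>m\<close> would vanish on all initial terms, hence on their span.\<close>

lemma init_ideal_monomE:
  fixes I :: "('v::linorder, 'k::field) mpol set"
  assumes "monom m \<in> init_ideal I"
  obtains f where "f \<in> I" "f \<noteq> 0" "Max (Poly_Mapping.keys f) = m"
proof (rule ccontr)
  assume no: "\<not> thesis"
  have "init_ideal I \<subseteq> {f. Poly_Mapping.lookup f m = 0}"
    unfolding init_ideal_def
  proof (rule vs.span_minimal)
    show "init_term ` I \<subseteq> {f. Poly_Mapping.lookup f m = 0}"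
      using no that by (force simp: init_term_def Let_def lookup_single when_def)
    show "vs.subspace {f :: ('v, 'k) mpol. Poly_Mapping.lookup f m = 0}"
      by (auto simp: vs.subspace_def lookup_add)
  qed
  with assms show False
    by (auto simp: lookup_monom)
qed

text \<open>Pure lex does not compare degrees first, but passing to the component of degree d + k
  keeps \<open>m\<close> and only removes other monomials, so \<open>m\<close> stays the leading
  one.\<close>

lemma init_ideal_monom_homogeneousE:
  fixes F G :: "('v::{finite,linorder}, 'k::field) mpol"
  assumes F: "Poly_Mapping.keys F \<subseteq> mons k" and G: "Poly_Mapping.keys G \<subseteq> mons k"
    and m: "monom m \<in> init_ideal (ideal.span {F, G})" "mdeg m = d + k"
  obtains f where "f \<in> vs.span (multiples (mons d) F (mons d) G)" "f \<noteq> 0"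
    "Max (Poly_Mapping.keys f) = m"
proof -
  obtain f where f: "f \<in> ideal.span {F, G}" "f \<noteq> 0" "Max (Poly_Mapping.keys f) = m"
    using m(1) by (rule init_ideal_monomE)
  have "m \<in> Poly_Mapping.keys (hcomp (d + k) f)"
    using f m(2) Max_in[of "Poly_Mapping.keys f"] by (auto simp: keys_hcomp)
  moreover have "n \<le> m" if "n \<in> Poly_Mapping.keys (hcomp (d + k) f)" for n
    using f that by (auto simp: keys_hcomp)
  ultimately have "hcomp (d + k) f \<noteq> 0" "Max (Poly_Mapping.keys (hcomp (d + k) f)) = m"
    by (auto intro: Max_eqI)
  with that hcomp_ideal[OF F G f(1), of d] show thesis
    by blast
qed

section \<open>Monomials in four variables and the role of x_1\<close>

definition mon4 :: "nat \<Rightarrow> nat \<Rightarrow> nat \<Rightarrow> nat \<Rightarrow> 4 mon" where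
  "mon4 a b c d = Poly_Mapping.single 0 a + Poly_Mapping.single 1 b
    + Poly_Mapping.single 2 c + Poly_Mapping.single 3 d"

lemma lookup_mon4 [simp]:
  "Poly_Mapping.lookup (mon4 a b c d) 0 = a" "Poly_Mapping.lookup (mon4 a b c d) 1 = b"
  "Poly_Mapping.lookup (mon4 a b c d) 2 = c" "Poly_Mapping.lookup (mon4 a b c d) 3 = d"
  by (simp_all add: mon4_def lookup_add lookup_single when_def)

lemma mon4_eq_iff: "mon4 a b c d = mon4 a' b' c' d' \<longleftrightarrow> a = a' \<and> b = b' \<and> c = c' \<and> d = d'"
  by (metis lookup_mon4)

lemma mdeg_mon4: "mdeg (mon4 a b c d) = a + b + c + d"
  by (simp add: mon4_def)

text \<open>The exponents of x_1, x_2, x_3 form any triple of sum at most 3, and x_4 fills up the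
  degree; there are 20 such triples.\<close>

lemma card_mons_3: "card (mons 3 :: 4 mon set) \<ge> 20"
proof -
  define T :: "(nat \<times> nat \<times> nat) set" where
    "T = (SIGMA a:{..3}. SIGMA b:{..3 - a}. {..3 - a - b})"
  let ?f = "\<lambda>(a, b, c). mon4 a b c (3 - (a + b + c))"
  have "card T = 20"
    by (simp add: T_def numeral_eq_Suc)
  moreover have "card T \<le> card (mons 3 :: 4 mon set)"
  proof (rule card_inj_on_le[OF _ _ finite_mdeg])
    show "inj_on ?f T"
      by (auto simp: inj_on_def mon4_eq_iff)
    show "?f ` T \<subseteq> mons 3"
      by (auto simp: T_def mdeg_mon4)
  qed
  ultimately show ?thesis
    by simp
qed

text \<open>x_1 has the least index, so a difference in its exponent decides a lexicographic
  comparison at once.\<close>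

lemma not_less_zero_4: "\<not> i < (0::4)"
proof -
  have "(0::4) < 2" "(0::4) < 3"
    using less_4 by order+
  moreover have "i \<in> {0, 1, 2, 3}"
    using UNIV_I[of i] unfolding Defs.UNIV_4 .
  ultimately show ?thesis
    using less_4(1) by (auto dest: less_asym)
qed

lemma lex_less_of_lookup_0:
  "Poly_Mapping.lookup m 0 < Poly_Mapping.lookup m' 0 \<Longrightarrow> m < m'" for m m' :: "4 mon"
  unfolding mon_less_iff_lex using not_less_zero_4 by blast

lemma mon_eq_single:
  fixes m :: "'v::finite mon"
  assumes "mdeg m \<le> Poly_Mapping.lookup m i"
  shows "m = Poly_Mapping.single i (mdeg m)"
proof (rule poly_mapping_eqI)
  fix j
  have "mdeg m = Poly_Mapping.lookup m i + (\<Sum>j\<in>UNIV - {i}. Poly_Mapping.lookup m j)"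
    unfolding mdeg_def by (rule sum.remove) auto
  then have "mdeg m = Poly_Mapping.lookup m i" "\<forall>j. j \<noteq> i \<longrightarrow> Poly_Mapping.lookup m j = 0"
    using assms by auto
  then show "Poly_Mapping.lookup m j = Poly_Mapping.lookup (Poly_Mapping.single i (mdeg m)) j"
    by (auto simp: lookup_single when_def)
qed

text \<open>Index \<open>0\<close> stands for x_1, so these are the monomials in x_2, x_3,
  x_4.\<close>

abbreviation tail_mons :: "nat \<Rightarrow> 4 mon set" where
  "tail_mons d \<equiv> {m. mdeg m = d \<and> Poly_Mapping.lookup m 0 = 0}"

lemma keys_mult_tail_mons:
  fixes f g :: "(4, 'k::field) mpol"
  assumes "Poly_Mapping.keys f \<subseteq> tail_mons d" "Poly_Mapping.keys g \<subseteq> tail_mons k"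
  shows "Poly_Mapping.keys (f * g) \<subseteq> tail_mons (d + k)"
  using keys_mult[of f g] assms by (fastforce simp: lookup_add)

lemma keys_add_subset:
  "Poly_Mapping.keys f \<subseteq> A \<Longrightarrow> Poly_Mapping.keys g \<subseteq> A \<Longrightarrow> Poly_Mapping.keys (f + g) \<subseteq> A"
  using keys_add[of f g] by blast

lemma keys_diff_subset:
  fixes f g :: "'a \<Rightarrow>\<^sub>0 'b::ab_group_add"
  shows "Poly_Mapping.keys f \<subseteq> A \<Longrightarrow> Poly_Mapping.keys g \<subseteq> A \<Longrightarrow> Poly_Mapping.keys (f - g) \<subseteq> A"
  using keys_diff[of f g] by blast

lemma keys_smult_subset: "Poly_Mapping.keys f \<subseteq> A \<Longrightarrow> Poly_Mapping.keys (smult c f) \<subseteq> A"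
  by (metis in_keys_iff lookup_smult mult_zero_right subset_iff)

lemma keys_sum_monom_subset:
  "Poly_Mapping.keys (\<Sum>m\<in>A. smult (c m) (monom m) :: ('v, 'k::field) mpol) \<subseteq> A"
proof
  fix n assume "n \<in> Poly_Mapping.keys (\<Sum>m\<in>A. smult (c m) (monom m) :: ('v, 'k) mpol)"
  then have "(\<Sum>m\<in>A. c m * Poly_Mapping.lookup (monom m) n) \<noteq> 0"
    by (simp add: in_keys_iff lookup_sum)
  then obtain m where "m \<in> A" "c m * Poly_Mapping.lookup (monom m) n \<noteq> 0"
    by (rule sum.not_neutral_contains_not_neutral)
  then show "n \<in> A"
    by (simp add: lookup_monom when_def split: if_splits)
qed

text \<open>Sorting the quadratic monomials by their exponent of x_1, which is 2, 1 or 0, writes F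
  as a polynomial in x_1 over k[x_2, x_3, x_4].\<close>

lemma quadric_expansion:
  fixes F :: "(4, 'k::field) mpol"
  assumes F: "Poly_Mapping.keys F \<subseteq> mons 2"
  obtains a b where "Poly_Mapping.keys a \<subseteq> tail_mons 1" "Poly_Mapping.keys b \<subseteq> tail_mons 2"
    "F = smult (Poly_Mapping.lookup F (Poly_Mapping.single 0 2)) (monom (Poly_Mapping.single 0 2))
      + a * monom (Poly_Mapping.single 0 1) + b"
proof
  let ?x = "Poly_Mapping.single 0 1 :: 4 mon" and ?x2 = "Poly_Mapping.single 0 2 :: 4 mon"
  let ?t = "\<lambda>m. smult (Poly_Mapping.lookup F m) (monom m)"
  define a where "a = (\<Sum>m\<in>tail_mons 1. smult (Poly_Mapping.lookup F (m + ?x)) (monom m))"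
  define b where "b = (\<Sum>m\<in>tail_mons 2. ?t m)"
  show "Poly_Mapping.keys a \<subseteq> tail_mons 1" "Poly_Mapping.keys b \<subseteq> tail_mons 2"
    unfolding a_def b_def by (rule keys_sum_monom_subset)+
  have fin: "finite (tail_mons d)" for d
    by (rule finite_subset[OF _ finite_mdeg[of d]]) auto
  have mons: "mons 2 = insert ?x2 ((\<lambda>m. m + ?x) ` tail_mons 1 \<union> tail_mons 2)"
  proof (intro equalityI subsetI)
    fix m :: "4 mon" assume m: "m \<in> mons 2"
    have "Poly_Mapping.lookup m 0 \<le> 2"
      using lookup_le_mdeg[of m 0] m by simp
    then consider "Poly_Mapping.lookup m 0 = 0" | "Poly_Mapping.lookup m 0 = 1"
      | "Poly_Mapping.lookup m 0 = 2"
      by linarith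
    then show "m \<in> insert ?x2 ((\<lambda>m. m + ?x) ` tail_mons 1 \<union> tail_mons 2)"
    proof cases
      case 2
      \<comment> \<open>Subtraction of exponents truncates at 0; as x_1 has exponent 1 in
        \<open>m\<close>, nothing is lost here.\<close>
      have eq: "m = (m - ?x) + ?x"
        by (rule poly_mapping_eqI)
          (use 2 in \<open>auto simp: lookup_add lookup_minus lookup_single when_def\<close>)
      then have "mdeg m = mdeg (m - ?x) + 1"
        by (metis mdeg_add mdeg_single)
      then have "m - ?x \<in> tail_mons 1"
        using m 2 by (simp add: lookup_minus)
      then show ?thesis
        using eq by blast
    qed (use m mon_eq_single[of m 0] in auto)
  qed auto
  have "F = (\<Sum>m\<in>mons 2. ?t m)"
    using hcomp_homogeneous[OF F, of 2] by (simp add: hcomp_def)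
  also have "\<dots> = ?t ?x2 + (\<Sum>m\<in>(\<lambda>m. m + ?x) ` tail_mons 1 \<union> tail_mons 2. ?t m)"
    unfolding mons
    by (rule sum.insert)
      (auto simp: fin lookup_add dest!: arg_cong[of ?x2 _ "\<lambda>m. Poly_Mapping.lookup m 0"])
  also have "(\<Sum>m\<in>(\<lambda>m. m + ?x) ` tail_mons 1 \<union> tail_mons 2. ?t m)
      = (\<Sum>m\<in>(\<lambda>m. m + ?x) ` tail_mons 1. ?t m) + b"
    unfolding b_def by (rule sum.union_disjoint) (auto simp: fin lookup_add)
  also have "(\<Sum>m\<in>(\<lambda>m. m + ?x) ` tail_mons 1. ?t m) = a * monom ?x"
    by (simp add: a_def sum.reindex inj_on_def sum_distrib_right smult_mult_left monom_mult)
  finally show "F = ?t ?x2 + a * monom ?x + b"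
    by (simp add: add.assoc)
qed

section \<open>Counting initial monomials in degree 4\<close>

text \<open>The leading monomial of \<open>f\<close> lies below every quartic monomial divisible by
  x_1. A lexsegment initial ideal would thus have at least 1 + 20 monomials in degree 4, against at
  most 20 spanning products.\<close>

lemma tail_element_not_lexsegment:
  fixes F G f :: "(4, 'k::field) mpol"
  assumes F: "Poly_Mapping.keys F \<subseteq> mons 2" and G: "Poly_Mapping.keys G \<subseteq> mons 2"
    and f: "f \<in> ideal.span {F, G}" "f \<noteq> 0" "Poly_Mapping.keys f \<subseteq> tail_mons 4"
    and card2: "card (mons 2 :: 4 mon set) = 10"
  shows "\<not> lexsegment_ideal (init_ideal (ideal.span {F, G}))"
proof
  assume lex: "lexsegment_ideal (init_ideal (ideal.span {F, G}))"
  let ?W = "multiples (mons 2) F (mons 2) G" and ?x = "Poly_Mapping.single 0 1 :: 4 mon"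
  define n where "n = Max (Poly_Mapping.keys f)"
  \<comment> \<open>x_1 times each cubic monomial, together with \<open>n\<close>, which is free of
    x_1.\<close>
  define M where "M = insert n ((\<lambda>m. m + ?x) ` mons 3)"
  have n: "n \<in> tail_mons 4"
    unfolding n_def using f(2,3) by (intro subsetD[OF f(3)] Max_in) auto
  have "monom n \<in> init_ideal (ideal.span {F, G})"
    unfolding n_def by (rule monom_Max_in_init_ideal) (use f in auto)
  moreover have "mdeg m = mdeg n \<and> n \<le> m" if "m \<in> M" for m
    using that n by (auto simp: M_def lookup_add intro!: less_imp_le lex_less_of_lookup_0)
  ultimately have M: "monom m \<in> init_ideal (ideal.span {F, G})" "mdeg m = 2 + 2" if "m \<in> M" for m
    using lex that n unfolding lexsegment_ideal_def by (blast, force)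
  have "\<exists>g. g \<in> vs.span ?W \<and> g \<noteq> 0 \<and> Max (Poly_Mapping.keys g) = m" if "m \<in> M" for m
    using init_ideal_monom_homogeneousE[OF F G M[OF that]] by metis
  \<comment> \<open>One element of the span for each leading monomial in \<open>M\<close>; these are
    independent, so \<open>card M\<close> cannot exceed \<open>card ?W\<close>.\<close>
  then obtain g where g: "\<And>m. m \<in> M \<Longrightarrow> g m \<in> vs.span ?W \<and> g m \<noteq> 0 \<and> Max (Poly_Mapping.keys (g m)) = m"
    by metis
  have "finite M"
    by (simp add: M_def finite_mdeg)
  note ind = independent_distinct_Max_keys[OF this, of g]
  have "card (g ` M) = card M"
    using ind(1) g by (intro card_image) auto
  also have "card M = Suc (card (mons 3 :: 4 mon set))"
  proof -
    have "n \<notin> (\<lambda>m. m + ?x) ` mons 3"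
      using n by (auto simp: lookup_add)
    moreover have "card ((\<lambda>m. m + ?x) ` mons 3) = card (mons 3 :: 4 mon set)"
      by (intro card_image) (auto simp: inj_on_def)
    ultimately show ?thesis
      by (simp add: M_def finite_mdeg)
  qed
  finally have "card (g ` M) \<ge> 21"
    using card_mons_3 by simp
  moreover have "card (g ` M) \<le> card ?W"
    using vs.independent_span_bound[of ?W "g ` M"] ind(2) g
    by (auto simp: finite_multiples finite_mdeg)
  moreover have "card ?W \<le> 20"
    using card_multiples[of "mons 2" "mons 2" F G] card2 by (simp add: finite_mdeg)
  ultimately show False
    by simp
qed

section \<open>Elimination of x_1 and syzygies\<close>

text \<open>Pseudo-division by l x + c: after multiplying the quadratic by l^2, the quotient is u l
  x + a l - u c and the remainder is the resultant with respect to x.\<close>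

lemma resultant_identity:
  fixes a b c l u x :: "'a::comm_ring_1"
  shows "u * c * c - a * c * l + b * l * l
    = (l * l) * (u * x * x + a * x + b) - (u * l * x + a * l - u * c) * (l * x + c)"
  by (simp add: algebra_simps)

text \<open>The Koszul syzygy makes $x_1^2 G$ redundant among the $20$ products spanning $(I)_4$; the given
  one, which does not involve $x_1^2 G$, makes a multiple of \<open>F\<close> redundant.\<close>

lemma dim_le_of_syzygy:
  fixes F G p q :: "(4, 'k::field) mpol"
  assumes F: "Poly_Mapping.keys F \<subseteq> mons 2" and G: "Poly_Mapping.keys G \<subseteq> mons 2"
    and lc: "Poly_Mapping.lookup F (Poly_Mapping.single 0 2) \<noteq> 0"
    and p: "Poly_Mapping.keys p \<subseteq> mons 2" "p \<noteq> 0"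
    and q: "Poly_Mapping.keys q \<subseteq> mons 2 - {Poly_Mapping.single 0 2}"
    and syz: "p * F = q * G"
    and card2: "card (mons 2 :: 4 mon set) = 10"
  shows "vs.dim (graded_part (ideal.span {F, G}) 4) \<le> 18"
proof -
  let ?x2 = "Poly_Mapping.single 0 2 :: 4 mon"
  obtain n where n: "n \<in> Poly_Mapping.keys p"
    using p(2) by (metis all_not_in_conv keys_eq_empty)
  \<comment> \<open>At most 9 + 9 products remain: \<open>n\<close> is any monomial of
    \<open>p\<close>, and x_1^2 G is left out.\<close>
  define W where "W = multiples (mons 2 - {n}) F (mons 2 - {?x2}) G"
  have base: "monom m * F \<in> vs.span W" if "m \<in> mons 2 - {n}" for m
    using that by (auto simp: W_def multiples_def intro!: vs.span_base)
  have base': "monom m * G \<in> vs.span W" if "m \<in> mons 2 - {?x2}" for m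
    using that by (auto simp: W_def multiples_def intro!: vs.span_base)
  \<comment> \<open>As \<open>q\<close> avoids x_1^2, the right side of the syzygy uses kept
    products only; solving for the term at \<open>n\<close> recovers n F.\<close>
  have "p * F \<in> vs.span W"
    unfolding syz W_def by (rule mult_in_span_multiples(2)[OF q])
  then have nF: "monom n * F \<in> vs.span W"
    using base n p(1) by (intro pivot_in_span[of p n "mons 2 - {n}"]) (auto simp: in_keys_iff)
  then have F_in: "monom m * F \<in> vs.span W" if "m \<in> mons 2" for m
    using base that by (cases "m = n") auto
  have "(\<lambda>m. monom m * F) ` mons 2 \<subseteq> vs.span W"
    using F_in by auto
  then have "vs.span ((\<lambda>m. monom m * F) ` mons 2) \<subseteq> vs.span W"
    by (rule vs.span_minimal[OF _ vs.subspace_span])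
  \<comment> \<open>Koszul syzygy: G F expands into multiples of F, all in the span by now. Read as
    F G, it can be solved for x_1^2 G because F has a nonzero coefficient at x_1^2.\<close>
  then have "F * G \<in> vs.span W"
    using mult_in_span[OF G, of F] unfolding mult.commute[of F G] by (rule subsetD)
  then have "monom ?x2 * G \<in> vs.span W"
    using base' F lc by (intro pivot_in_span[of F ?x2 "mons 2 - {?x2}"]) auto
  then have "monom m * G \<in> vs.span W" if "m \<in> mons 2" for m
    using base' that by (cases "m = ?x2") auto
  with F_in have "multiples (mons 2) F (mons 2) G \<subseteq> vs.span W"
    by (auto simp: multiples_def)
  then have "vs.span (multiples (mons 2) F (mons 2) G) \<subseteq> vs.span W"
    by (rule vs.span_minimal[OF _ vs.subspace_span])
  moreover have "graded_part (ideal.span {F, G}) 4 \<subseteq> vs.span (multiples (mons 2) F (mons 2) G)"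
    using graded_part_subset_span[OF F G, of 2] by simp
  ultimately have "vs.dim (graded_part (ideal.span {F, G}) 4) \<le> card W"
    by (intro vs.dim_le_card) (auto simp: W_def finite_multiples finite_mdeg)
  also have "card W \<le> card (mons 2 - {n}) + card (mons 2 - {?x2})"
    unfolding W_def by (rule card_multiples) (auto simp: finite_mdeg)
  also have "\<dots> = 18"
    using n p(1) card2 by (subst (1 2) card_Diff_singleton) auto
  finally show ?thesis .
qed

text \<open>The resultant in x_1 is the witness. Were it zero, the dimension would be at most 18, by
  a second syzygy or because \<open>G = 0\<close>.\<close>

lemma exists_tail_element:
  fixes F G :: "(4, 'k::field) mpol"
  assumes F: "Poly_Mapping.keys F \<subseteq> mons 2" and G: "Poly_Mapping.keys G \<subseteq> mons 2"
    and lc: "Poly_Mapping.lookup F (Poly_Mapping.single 0 2) \<noteq> 0"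
    and G0: "Poly_Mapping.lookup G (Poly_Mapping.single 0 2) = 0"
    and dim: "vs.dim (graded_part (ideal.span {F, G}) 4) \<ge> 19"
    and card2: "card (mons 2 :: 4 mon set) = 10"
  obtains f where "f \<in> ideal.span {F, G}" "f \<noteq> 0" "Poly_Mapping.keys f \<subseteq> tail_mons 4"
proof -
  define X where "X = (monom (Poly_Mapping.single 0 1) :: (4, 'k) mpol)"
  \<comment> \<open>The leading coefficient of F in x_1 as a constant polynomial: the outer
    \<open>0\<close> is the trivial exponent vector, the inner one is the index of x_1.\<close>
  define u where "u = (Poly_Mapping.single 0 (Poly_Mapping.lookup F (Poly_Mapping.single 0 2)) :: (4, 'k) mpol)"
  have u: "Poly_Mapping.keys u \<subseteq> tail_mons 0" "u \<noteq> 0"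
    using lc by (simp_all add: u_def mdeg_def flip: keys_eq_empty)
  have XX: "monom (Poly_Mapping.single 0 2) = X * X"
    by (simp add: X_def monom_mult numeral_2_eq_2 flip: single_add)
  obtain a b where ab: "Poly_Mapping.keys a \<subseteq> tail_mons 1" "Poly_Mapping.keys b \<subseteq> tail_mons 2"
    and F_exp: "F = smult (Poly_Mapping.lookup F (Poly_Mapping.single 0 2)) (monom (Poly_Mapping.single 0 2))
      + a * monom (Poly_Mapping.single 0 1) + b"
    by (rule quadric_expansion[OF F])
  have Feq: "F = u * X * X + a * X + b"
    by (rule trans[OF F_exp]) (simp only: XX u_def X_def smult_def mult.assoc)
  obtain l c where lc: "Poly_Mapping.keys l \<subseteq> tail_mons 1" "Poly_Mapping.keys c \<subseteq> tail_mons 2"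
    and G_exp: "G = smult (Poly_Mapping.lookup G (Poly_Mapping.single 0 2)) (monom (Poly_Mapping.single 0 2))
      + l * monom (Poly_Mapping.single 0 1) + c"
    by (rule quadric_expansion[OF G])
  have Geq: "G = l * X + c"
    by (rule trans[OF G_exp]) (simp only: G0 X_def vs.scale_zero_left add_0)
  note keys = u(1) ab lc
  \<comment> \<open>\<open>R\<close> is the resultant and \<open>Q\<close> the pseudo-quotient of
    l^2 F by G.\<close>
  define R where "R = u * c * c - a * c * l + b * l * l"
  define Q where "Q = u * l * X + a * l - u * c"
  have R: "R = (l * l) * F - Q * G"
    unfolding R_def Q_def Feq Geq by (rule resultant_identity)
  have Rtail: "Poly_Mapping.keys R \<subseteq> tail_mons 4"
  proof -
    have "Poly_Mapping.keys (u * c * c) \<subseteq> tail_mons (0 + 2 + 2)"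
      "Poly_Mapping.keys (a * c * l) \<subseteq> tail_mons (1 + 2 + 1)"
      "Poly_Mapping.keys (b * l * l) \<subseteq> tail_mons (2 + 1 + 1)"
      by (intro keys_mult_tail_mons keys)+
    then show ?thesis
      unfolding R_def by (intro keys_add_subset keys_diff_subset) auto
  qed
  show thesis
  proof (cases "R = 0")
    case False
    have "R \<in> ideal.span {F, G}"
      unfolding R by (intro ideal.span_diff ideal.span_scale ideal.span_base) auto
    then show thesis
      using that False Rtail by blast
  next
    case True
    let ?A = "mons 2 - {Poly_Mapping.single 0 2} :: 4 mon set"
    have tail: "tail_mons 2 \<subseteq> ?A"
      by auto
    have ul: "Poly_Mapping.keys (u * l) \<subseteq> tail_mons 1"
      "Poly_Mapping.keys (a * l) \<subseteq> tail_mons 2" "Poly_Mapping.keys (u * c) \<subseteq> tail_mons 2"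
      "Poly_Mapping.keys (l * l) \<subseteq> tail_mons 2"
      using keys_mult_tail_mons[OF u(1) lc(1)] keys_mult_tail_mons[OF ab(1) lc(1)]
        keys_mult_tail_mons[OF u(1) lc(2)] keys_mult_tail_mons[OF lc(1) lc(1)]
      by (simp_all add: numeral_2_eq_2)
    have "Poly_Mapping.keys (u * l * X) \<subseteq> ?A"
    proof
      fix m assume "m \<in> Poly_Mapping.keys (u * l * X)"
      then obtain n where "n \<in> tail_mons 1" "m = n + Poly_Mapping.single 0 1"
        using keys_mult[of "u * l" X] ul(1) by (auto simp: X_def)
      then have "mdeg m = 2" "Poly_Mapping.lookup m 0 = 1"
        by (simp_all add: lookup_add)
      then show "m \<in> ?A"
        by auto
    qed
    \<comment> \<open>Only the first summand of \<open>Q\<close> involves x_1, and only to the first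
      power.\<close>
    then have Q: "Poly_Mapping.keys Q \<subseteq> ?A"
      unfolding Q_def using ul tail by (intro keys_add_subset keys_diff_subset) auto
    \<comment> \<open>For nonzero \<open>l\<close>, R = 0 is the syzygy l^2 F = Q G with l^2
      nonzero. For \<open>l = 0\<close> it reads u c^2 = 0, so c and hence G vanish and at most 10
      products remain.\<close>
    have "vs.dim (graded_part (ideal.span {F, G}) 4) \<le> 18"
    proof (cases "l = 0")
      case False
      have "(l * l) * F = Q * G"
        using R True by simp
      then show ?thesis
        using dim_le_of_syzygy[OF F G \<open>Poly_Mapping.lookup F (Poly_Mapping.single 0 2) \<noteq> 0\<close>,
            of "l * l" Q] ul(4) False Q card2 by auto
    next
      case True
      with \<open>R = 0\<close> have "u * (c * c) = 0"
        by (simp add: R_def mult.assoc)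
      then have "G = 0"
        using u(2) True by (simp add: Geq)
      let ?V = "multiples (mons 2) F {} G"
      have "multiples (mons 2) F (mons 2) G \<subseteq> vs.span ?V"
        unfolding multiples_def by (auto simp: \<open>G = 0\<close> vs.span_zero intro: vs.span_base)
      then have "vs.span (multiples (mons 2) F (mons 2) G) \<subseteq> vs.span ?V"
        by (rule vs.span_minimal[OF _ vs.subspace_span])
      then have "vs.dim (graded_part (ideal.span {F, G}) 4) \<le> card ?V"
        using graded_part_subset_span[OF F G, of 2]
        by (intro vs.dim_le_card) (auto simp: finite_multiples finite_mdeg)
      also have "card ?V \<le> 10"
        using card_multiples[of "mons 2" "{}" F G] card2 by (simp add: finite_mdeg)
      finally show ?thesis
        by simp
    qed
    with dim show thesis
      by simp
  qed
qed

section \<open>Normalising the generators\<close>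

text \<open>The lexsegment property makes x_1^2 an initial monomial, so some generator involves it.
  Clearing x_1^2 from the other one prepares the elimination, whose result contradicts the count in
  degree 4.\<close>

lemma not_lexsegment_of_dim:
  fixes F G :: "(4, 'k::field) mpol"
  assumes F: "Poly_Mapping.keys F \<subseteq> mons 2" and G: "Poly_Mapping.keys G \<subseteq> mons 2"
    and dim: "vs.dim (graded_part (ideal.span {F, G}) 4) \<ge> 19"
    and card2: "card (mons 2 :: 4 mon set) = 10"
  shows "\<not> lexsegment_ideal (init_ideal (ideal.span {F, G}))"
proof
  let ?I = "ideal.span {F, G}" and ?x2 = "Poly_Mapping.single 0 2 :: 4 mon"
  assume lex: "lexsegment_ideal (init_ideal ?I)"
  \<comment> \<open>The roles are left open because either of \<open>F\<close> and \<open>G\<close>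
    may carry x_1^2.\<close>
  have contra: False if P: "Poly_Mapping.keys P \<subseteq> mons 2" and Q: "Poly_Mapping.keys Q \<subseteq> mons 2"
    and I: "?I = ideal.span {P, Q}" and lc: "Poly_Mapping.lookup P ?x2 \<noteq> 0" for P Q
  proof -
    \<comment> \<open>The multiple of \<open>P\<close> that cancels x_1^2 in \<open>Q\<close>; the
      ideal does not change.\<close>
    define r where "r = Poly_Mapping.lookup Q ?x2 / Poly_Mapping.lookup P ?x2"
    define Q' where "Q' = Q - smult r P"
    have Q': "Poly_Mapping.keys Q' \<subseteq> mons 2"
      unfolding Q'_def by (intro keys_diff_subset keys_smult_subset P Q)
    have Q'0: "Poly_Mapping.lookup Q' ?x2 = 0"
      using lc by (simp add: Q'_def r_def lookup_minus)
    have "Q' \<in> ideal.span {P, Q}"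
      unfolding Q'_def smult_def by (intro ideal.span_diff ideal.span_scale ideal.span_base) auto
    moreover have "smult r P + Q' \<in> ideal.span {P, Q'}"
      unfolding smult_def by (intro ideal.span_add ideal.span_scale ideal.span_base) auto
    then have "Q \<in> ideal.span {P, Q'}"
      by (simp add: Q'_def)
    ultimately have I': "ideal.span {P, Q} = ideal.span {P, Q'}"
      unfolding ideal.span_eq by (auto intro: ideal.span_base)
    obtain f where "f \<in> ideal.span {P, Q'}" "f \<noteq> 0" "Poly_Mapping.keys f \<subseteq> tail_mons 4"
      by (rule exists_tail_element[OF P Q' lc Q'0 _ card2]) (use dim in \<open>simp only: I I'\<close>)
    from tail_element_not_lexsegment[OF P Q' this card2] lex show False
      by (simp only: I I')
  qed
  have "F \<noteq> 0 \<or> G \<noteq> 0"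
  proof (rule ccontr)
    assume "\<not> ?thesis"
    then have "?I \<subseteq> {0}"
      unfolding ideal_span_pair by auto
    then have "vs.dim (graded_part ?I 4) \<le> card ({} :: (4, 'k) mpol set)"
      by (intro vs.dim_le_card) (auto simp: graded_part_def)
    with dim show False
      by simp
  qed
  then obtain H where H: "H \<in> {F, G}" "H \<noteq> 0"
    by blast
  define m where "m = Max (Poly_Mapping.keys H)"
  have m: "mdeg m = 2"
  proof -
    have "Poly_Mapping.keys H \<subseteq> mons 2"
      using H(1) F G by blast
    moreover have "m \<in> Poly_Mapping.keys H"
      unfolding m_def using H(2) by (intro Max_in) auto
    ultimately show ?thesis
      by blast
  qed
  \<comment> \<open>x_1^2 is the largest quadratic monomial: exponent 2 at x_1 forces equality, and
    a smaller exponent decides the comparison.\<close>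
  have "m \<le> ?x2"
  proof (cases "Poly_Mapping.lookup m 0 = 2")
    case True
    then show ?thesis
      using m mon_eq_single[of m 0] by simp
  next
    case False
    then have "Poly_Mapping.lookup m 0 < Poly_Mapping.lookup ?x2 0"
      using lookup_le_mdeg[of m 0] m by simp
    then show ?thesis
      by (intro less_imp_le lex_less_of_lookup_0)
  qed
  moreover have "monom m \<in> init_ideal ?I"
    unfolding m_def using H by (intro monom_Max_in_init_ideal ideal.span_base)
  ultimately have "monom ?x2 \<in> init_ideal ?I"
    using lex m by (auto simp: lexsegment_ideal_def)
  \<comment> \<open>In degree 2 the multipliers have degree 0, so \<open>f\<close> is a scalar
    combination of F and G and can only get x_1^2 from one of them.\<close>
  then obtain f where f: "f \<in> vs.span (multiples (mons 0) F (mons 0) G)" "f \<noteq> 0"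
    "Max (Poly_Mapping.keys f) = ?x2"
    by (rule init_ideal_monom_homogeneousE[OF F G]) simp
  have "f \<in> {f. Poly_Mapping.lookup f ?x2 = 0}"
    if zero: "Poly_Mapping.lookup F ?x2 = 0" "Poly_Mapping.lookup G ?x2 = 0"
  proof (rule subsetD[OF vs.span_minimal f(1)])
    have "m = 0" if "mdeg m = 0" for m :: "4 mon"
      using mon_eq_single[of m 0] that by simp
    moreover have "mdeg (0 :: 4 mon) = 0"
      by (simp add: mdeg_def)
    ultimately have "mons 0 = {0 :: 4 mon}"
      by blast
    then show "multiples (mons 0) F (mons 0) G \<subseteq> {f. Poly_Mapping.lookup f ?x2 = 0}"
      using zero by (simp add: multiples_def monom_def single_one)
    show "vs.subspace {f :: (4, 'k) mpol. Poly_Mapping.lookup f ?x2 = 0}"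
      by (auto simp: vs.subspace_def lookup_add)
  qed
  moreover have "?x2 \<in> Poly_Mapping.keys f"
    using f Max_in[of "Poly_Mapping.keys f"] by simp
  ultimately have "Poly_Mapping.lookup F ?x2 \<noteq> 0 \<or> Poly_Mapping.lookup G ?x2 \<noteq> 0"
    by (auto simp: in_keys_iff)
  then show False
    using contra[OF F G] contra[OF G F] by (auto simp: insert_commute)
qed

section \<open>The comparison point and the maximal locus\<close>

text \<open>The quartic multiples of x_1^2 and those of x_2^2 are two sets of 10 monomials sharing
  at most x_1^2 x_2^2. So at least 10 + 10 - 1 are distinct, and distinct monomials are
  independent.\<close>

lemma dim_graded_part_squares:
  assumes card2: "card (mons 2 :: 4 mon set) = 10"
  shows "vs.dim (graded_part (ideal.span {monom (Poly_Mapping.single 0 2),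
    monom (Poly_Mapping.single 1 2) :: (4, 'k::field) mpol}) 4) \<ge> 19"
proof -
  let ?x = "Poly_Mapping.single 0 2 :: 4 mon" and ?y = "Poly_Mapping.single 1 2 :: 4 mon"
  let ?I = "ideal.span {monom ?x, monom ?y :: (4, 'k) mpol}"
  let ?A = "(\<lambda>m. m + ?x) ` mons 2" and ?B = "(\<lambda>m. m + ?y) ` mons 2"
  have fin: "finite (?A \<union> ?B)"
    by (simp add: finite_mdeg)
  have "?A \<inter> ?B \<subseteq> {?x + ?y}"
  proof
    fix n assume n: "n \<in> ?A \<inter> ?B"
    obtain m where "n = m + ?x" "mdeg m = 2"
      using n by blast
    moreover obtain m' where "n = m' + ?y"
      using n by blast
    ultimately have m: "n = m + ?x" "n = m' + ?y" "mdeg m = 2"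
      by auto
    \<comment> \<open>Compare exponents of x_2: on the left it is that of \<open>m\<close>, on the
      right at least 2, the degree of \<open>m\<close>; so m is x_2^2.\<close>
    then have "Poly_Mapping.lookup (m + ?x) 1 = Poly_Mapping.lookup (m' + ?y) 1"
      by metis
    then have "mdeg m \<le> Poly_Mapping.lookup m 1"
      using m(3) by (simp add: lookup_add lookup_single)
    then show "n \<in> {?x + ?y}"
      using mon_eq_single[of m 1] m by (simp add: add.commute)
  qed
  then have "card (?A \<inter> ?B) \<le> 1"
    using card_mono[of "{?x + ?y}" "?A \<inter> ?B"] by simp
  moreover have "card ?A = 10" "card ?B = 10"
    using card2 by (subst card_image; simp add: inj_on_def)+
  ultimately have "card (?A \<union> ?B) \<ge> 19"
    using card_Un_Int[of ?A ?B] by (simp add: finite_mdeg)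
  also have ind: "inj_on (monom :: _ \<Rightarrow> (4, 'k) mpol) (?A \<union> ?B)"
    "vs.independent ((monom :: _ \<Rightarrow> (4, 'k) mpol) ` (?A \<union> ?B))"
    using independent_distinct_Max_keys[OF fin, of "monom :: _ \<Rightarrow> (4, 'k) mpol"]
    by (auto simp flip: keys_eq_empty)
  then have "card (?A \<union> ?B) = card ((monom :: _ \<Rightarrow> (4, 'k) mpol) ` (?A \<union> ?B))"
    by (simp add: card_image)
  also have "\<dots> \<le> vs.dim (graded_part ?I 4)"
  proof (rule vs.card_independent_le_dim[OF _ _ _ ind(2)])
    show "graded_part ?I 4 \<subseteq> vs.span (multiples (mons 2) (monom ?x) (mons 2) (monom ?y))"
      using graded_part_subset_span[of "monom ?x" 2 "monom ?y" 2] by simp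
    have "monom (m + ?x) \<in> ?I" "monom (m + ?y) \<in> ?I" for m
      by (auto simp flip: monom_mult intro!: ideal.span_scale intro: ideal.span_base)
    then show "monom ` (?A \<union> ?B) \<subseteq> graded_part ?I 4"
      by (auto simp: graded_part_def)
  qed (simp add: finite_multiples finite_mdeg)
  finally show ?thesis .
qed

text \<open>Coordinate vectors realise single monomials as generators, which the comparison point
  requires.\<close>

lemma gen_form_axis: "gen_form e (axis k 1) = monom (e k)"
proof -
  have "gen_form e (axis k 1) = (\<Sum>i\<in>UNIV. if i = k then monom (e k) else 0)"
    unfolding gen_form_def
    by (rule sum.cong) (auto simp: axis_def smult_def single_one)
  then show ?thesis
    by simp
qed

lemma keys_gen_form:
  fixes c :: "'k::field^'m::finite"
  assumes "range e \<subseteq> A"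
  shows "Poly_Mapping.keys (gen_form e c) \<subseteq> A"
proof
  fix m assume "m \<in> Poly_Mapping.keys (gen_form e c)"
  then have "(\<Sum>k\<in>UNIV. c $ k * Poly_Mapping.lookup (monom (e k)) m) \<noteq> 0"
    by (simp add: gen_form_def in_keys_iff lookup_sum)
  then obtain k where "c $ k * Poly_Mapping.lookup (monom (e k)) m \<noteq> 0"
    by (rule sum.not_neutral_contains_not_neutral)
  then show "m \<in> A"
    using assms by (auto simp: lookup_monom when_def split: if_splits)
qed

lemma point_ideal_2: "point_ideal e a = ideal.span {gen_form e (a $ 1), gen_form e (a $ 2)}"
  for a :: "'k::comm_ring_1^'m::finite^2"
proof -
  have "{gen_form e (a $ j) | j. True} = {gen_form e (a $ 1), gen_form e (a $ 2)}"
    by (simp add: full_SetCompr_eq UNIV_2)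
  then show ?thesis
    by (simp add: point_ideal_def)
qed

theorem corollary3p10:
  fixes e :: "10 \<Rightarrow> 4 mon"
  assumes "bij_betw e UNIV {m. mdeg m = 2}"
  shows "\<not> (\<exists>a :: 'k::field_char_0^10^2.
    a \<in> max_locus e \<and> lexsegment_ideal (init_ideal (point_ideal e a)))"
proof
  assume "\<exists>a :: 'k^10^2. a \<in> max_locus e \<and> lexsegment_ideal (init_ideal (point_ideal e a))"
  then obtain a :: "'k^10^2" where a: "a \<in> max_locus e"
    and lex: "lexsegment_ideal (init_ideal (point_ideal e a))"
    by blast
  have e: "range e = mons 2"
    using assms by (simp add: bij_betw_def)
  have card2: "card (mons 2 :: 4 mon set) = 10"
    using bij_betw_same_card[OF assms] by simp
  \<comment> \<open>The position of the square of variable \<open>i\<close> in the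
    enumeration.\<close>
  define k where "k i = inv e (Poly_Mapping.single i 2)" for i
  have k: "e (k i) = Poly_Mapping.single i 2" for i
    unfolding k_def by (rule f_inv_into_f) (simp add: e)
  \<comment> \<open>The point of the ideal (x_1^2, x_2^2); rows are indexed by \<open>1\<close> and
    \<open>2\<close>, so the second branch is row \<open>2\<close>.\<close>
  define z :: "'k^10^2" where "z = (\<chi> j. if j = 1 then axis (k 0) 1 else axis (k 1) 1)"
  have "hilb e z 4 \<ge> 19"
    using dim_graded_part_squares[OF card2, where 'k = 'k]
    by (simp add: hilb_def point_ideal_2 z_def gen_form_axis k)
  \<comment> \<open>The maximum over all points is at least the value at \<open>z\<close>, and
    \<open>a\<close> attains it in degree 4.\<close>
  moreover have "hilb e z 4 \<le> max_hilb TYPE('k^10^2) e 4"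
    unfolding max_hilb_def by (rule Max_ge[OF finite_hilb]) blast
  moreover have "hilb e a 4 = max_hilb TYPE('k^10^2) e 4"
    using a by (simp add: max_locus_def max_locus_deg_def)
  ultimately have "hilb e a 4 \<ge> 19"
    by simp
  moreover have "Poly_Mapping.keys (gen_form e (a $ j)) \<subseteq> mons 2" for j
    by (rule keys_gen_form) (simp add: e)
  ultimately show False
    using not_lexsegment_of_dim[OF _ _ _ card2] lex unfolding hilb_def point_ideal_2 by blast
qed

end
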